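(* Let $G=(I,A,\iota,(u_i)_{i\in I})$ be a game with infinite past. Assume that along each run at least two players are active infinitely often. Then the set of equilibrium runs of $G$ coincides with the set of strong equilibrium runs of $G$.
   Context: Let $\mathbb{Z}_0=\{\ldots,-2,-1,0\}$ and, for $n\in\mathbb{Z}_0$, $\mathbb{Z}_n=\{\ldots,n-1,n\}$. A game with infinite past is a tuple $G=(I,A,\iota,(u_i)_{i\in I})$ where $I$ is a nonempty finite set of players; $A$ is a finite set of actions with $|A|\ge 2$; a position in stage $n\in\mathbb{Z}_0$ is a sequence $p_n=(\ldots,a_{n-2},a_{n-1})\in P_n:=A^{\mathbb{Z}_{n-1}}$, and $P=\bigcup_{n\in\mathbb{Z}_0}P_n$ (a disjoint union); a run is a sequence $r=(\ldots,a_{-1},a_0)\in R:=A^{\mathbb{Z}_0}$; $\iota:P\to I$ assigns to each position the player who controls it (the active player); $u_i:R\to\mathbb{R}$ is a bounded payoff function for each $i\in I$. For a run $r=(\ldots,a_{-1},a_0)$, $r_{<n}=(\ldots,a_{n-2},a_{n-1})$ is the position in stage $n$ along $r$. A strategy of player $i$ is a map $s_i:\{p\in P:\iota(p)=i\}\to A$; a strategy profile is $s=(s_i)_{i\in I}$. A run $r=(\ldots,a_{-1},a_0)$ is consistent with $s_i$ if $a_n=s_i(r_{<n})$ for every $n\in\mathbb{Z}_0$ with $\iota(r_{<n})=i$; it is consistent with $s$ if it is consistent with every $s_i$. $R(s)$ is the set of runs consistent with $s$. Player $i$ is active infinitely often along $r$ if $\{n\in\mathbb{Z}_0:\iota(r_{<n})=i\}$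 is infinite. For a position $p_n\in P_n$, the subgame $G[p_n]$ is the finite game played in stages $n,\ldots,-1,0$ that arises when the actions up to stage $n-1$ are given by $p_n$; a strategy profile $s$ induces a strategy profile $s[p_n]$ in it. A traditional equilibrium of $G[p_n]$ is a pure Nash equilibrium of this finite game. Equilibrium: a pair $(s,r)$, with $s$ a strategy profile and $r\in R(s)$, such that for each $n\in\mathbb{Z}_0$, $s[r_{<n}]$ is a traditional equilibrium of $G[r_{<n}]$. A run $r$ is an equilibrium run if there is $s$ such that $(s,r)$ is an equilibrium. Strong equilibrium: a strategy profile $s$ with $R(s)=\{r\}$ for some run $r$ such that for each player $i$, each strategy $s'_i$ of player $i$ and each $r'\in R(s'_i,s_{-i})$ we have $u_i(r')\le u_i(r)$. A run $r$ is a strong equilibrium run if there is a strong equilibrium $s$ with $R(s)=\{r\}$. *)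

theory Defs
  imports Complex_Main
begin

text \<open>
  Stage \<open>-k\<close> of the past is represented by the natural number \<open>k\<close>, so stages grow into the past.
  A run \<open>r\<close> lists actions with the most recent one first: \<open>r k\<close> is the action taken in stage \<open>-k\<close>.
  A position in stage \<open>-k\<close> is a pair \<open>(k, p)\<close> whose sequence is again listed with the most recent
  action first: \<open>p j\<close> is the action taken in stage \<open>-k - 1 - j\<close>. The first component makes the union
  of the sets of positions over all stages a disjoint one.

  The finite set of players and the finite set of actions are the types \<open>'i\<close> and \<open>'a\<close>.
\<close>

type_synonym 'a run = "nat \<Rightarrow> 'a"
type_synonym 'a position = "nat \<times> (nat \<Rightarrow> 'a)"

record ('i, 'a) past_game =
  active :: "'a position \<Rightarrow> 'i"
  payoff :: "'i \<Rightarrow> 'a run \<Rightarrow> real"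

definition is_past_game :: "('i::finite, 'a::finite) past_game \<Rightarrow> bool" where
  "is_past_game G \<longleftrightarrow>
     card (UNIV :: 'a set) \<ge> 2 \<and> (\<forall>i. \<exists>B. \<forall>r. \<bar>payoff G i r\<bar> \<le> B)"

definition position_along :: "'a run \<Rightarrow> nat \<Rightarrow> 'a position" where
  "position_along r k = (k, \<lambda>j. r (Suc k + j))"

text \<open>
  A strategy is a total function on positions. Its values at positions that the player does not
  control are never consulted, neither below nor in the subgames.
\<close>

type_synonym 'a strategy = "'a position \<Rightarrow> 'a"
type_synonym ('i, 'a) profile = "'i \<Rightarrow> 'a strategy"

definition consistent :: "('i, 'a) past_game \<Rightarrow> 'i \<Rightarrow> 'a strategy \<Rightarrow> 'a run \<Rightarrow> bool" where
  "consistent G i \<sigma> r \<longleftrightarrow>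
     (\<forall>k. active G (position_along r k) = i \<longrightarrow> r k = \<sigma> (position_along r k))"

definition consistent_runs :: "('i, 'a) past_game \<Rightarrow> ('i, 'a) profile \<Rightarrow> 'a run set" where
  "consistent_runs G s = {r. \<forall>i. consistent G i (s i) r}"

definition active_infinitely_often :: "('i, 'a) past_game \<Rightarrow> 'i \<Rightarrow> 'a run \<Rightarrow> bool" where
  "active_infinitely_often G i r \<longleftrightarrow> infinite {k. active G (position_along r k) = i}"

text \<open>
  Finite games with perfect information in which one action is chosen in each of \<open>horizon\<close> stages.
  Histories are lists of actions in chronological order. The field \<open>mover\<close> matters only on histories
  shorter than \<open>horizon\<close>, the field \<open>utility\<close> only on those of length \<open>horizon\<close>.
\<close>

record ('i, 'a) finite_game =
  horizon :: nat
  mover :: "'a list \<Rightarrow> 'i"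
  utility :: "'i \<Rightarrow> 'a list \<Rightarrow> real"

primrec play :: "('i, 'a) finite_game \<Rightarrow> ('i \<Rightarrow> 'a list \<Rightarrow> 'a) \<Rightarrow> nat \<Rightarrow> 'a list" where
  "play F t 0 = []"
| "play F t (Suc m) = play F t m @ [t (mover F (play F t m)) (play F t m)]"

definition outcome :: "('i, 'a) finite_game \<Rightarrow> ('i \<Rightarrow> 'a list \<Rightarrow> 'a) \<Rightarrow> 'a list" where
  "outcome F t = play F t (horizon F)"

definition pure_nash_equilibrium ::
    "('i, 'a) finite_game \<Rightarrow> ('i \<Rightarrow> 'a list \<Rightarrow> 'a) \<Rightarrow> bool" where
  "pure_nash_equilibrium F t \<longleftrightarrow>
     (\<forall>i \<tau>. utility F i (outcome F (t(i := \<tau>))) \<le> utility F i (outcome F t))"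

text \<open>
  The past \<open>p\<close> (most recent action first) followed by the history \<open>h\<close> (chronological), again listed
  with the most recent action first.
\<close>

definition continue_past :: "(nat \<Rightarrow> 'a) \<Rightarrow> 'a list \<Rightarrow> (nat \<Rightarrow> 'a)" where
  "continue_past p h = (\<lambda>j. if j < length h then rev h ! j else p (j - length h))"

definition continue_position :: "'a position \<Rightarrow> 'a list \<Rightarrow> 'a position" where
  "continue_position q h = (fst q - length h, continue_past (snd q) h)"

text \<open>
  The subgame at a position in stage \<open>-k\<close> is played in the \<open>k + 1\<close> stages \<open>-k, \<dots>, 0\<close>; the past
  continued by a history of length \<open>k + 1\<close> is a run.
\<close>

definition subgame :: "('i, 'a) past_game \<Rightarrow> 'a position \<Rightarrow> ('i, 'a) finite_game" where
  "subgame G q =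
     \<lparr> horizon = Suc (fst q),
       mover = (\<lambda>h. active G (continue_position q h)),
       utility = (\<lambda>i h. payoff G i (continue_past (snd q) h)) \<rparr>"

definition induced_profile ::
    "('i, 'a) profile \<Rightarrow> 'a position \<Rightarrow> 'i \<Rightarrow> 'a list \<Rightarrow> 'a" where
  "induced_profile s q = (\<lambda>i h. s i (continue_position q h))"

definition traditional_equilibrium ::
    "('i, 'a) past_game \<Rightarrow> 'a position \<Rightarrow> ('i \<Rightarrow> 'a list \<Rightarrow> 'a) \<Rightarrow> bool" where
  "traditional_equilibrium G q t \<longleftrightarrow> pure_nash_equilibrium (subgame G q) t"

definition equilibrium :: "('i, 'a) past_game \<Rightarrow> ('i, 'a) profile \<Rightarrow> 'a run \<Rightarrow> bool" where
  "equilibrium G s r \<longleftrightarrow>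
     r \<in> consistent_runs G s \<and>
     (\<forall>k. traditional_equilibrium G (position_along r k) (induced_profile s (position_along r k)))"

definition equilibrium_run :: "('i, 'a) past_game \<Rightarrow> 'a run \<Rightarrow> bool" where
  "equilibrium_run G r \<longleftrightarrow> (\<exists>s. equilibrium G s r)"

definition strong_equilibrium :: "('i, 'a) past_game \<Rightarrow> ('i, 'a) profile \<Rightarrow> bool" where
  "strong_equilibrium G s \<longleftrightarrow>
     (\<exists>r. consistent_runs G s = {r} \<and>
          (\<forall>i \<sigma>. \<forall>r' \<in> consistent_runs G (s(i := \<sigma>)). payoff G i r' \<le> payoff G i r))"

definition strong_equilibrium_run :: "('i, 'a) past_game \<Rightarrow> 'a run \<Rightarrow> bool" where
  "strong_equilibrium_run G r \<longleftrightarrow> (\<exists>s. strong_equilibrium G s \<and> consistent_runs G s = {r})"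

end

theory Submission
  imports Defs
begin

text \<open>
  A strong equilibrium is an equilibrium because a deviation in a subgame on the equilibrium run is
  also a deviation in the whole game.

  Conversely, let \<open>(s, r)\<close> be an equilibrium. Keep \<open>s\<close> at the positions that agree with \<open>r\<close> in the
  distant past. Among the other runs choose a representative of each class of runs that agree in the
  distant past, and let every player deviate at each position from the representative of its class.
  A run outside the class of \<open>r\<close> eventually agrees with its representative, hence contradicts the
  strategy of every player who is active infinitely often; since there are two such players, the run
  cannot even be reached by a unilateral deviation. Within the class of \<open>r\<close> everything takes place in
  a subgame at a position along \<open>r\<close>.
\<close>

section \<open>Runs and the subgames at positions along them\<close>

lemma length_play [simp]: "length (play F t n) = n"
  by (induction n) auto

text \<open>Turns the recursive \<open>play\<close> into one condition per stage, the form that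
  consistency of runs has. Induction from the right end matches the recursion of
  \<open>play\<close>.\<close>

lemma eq_play_iff:
  "h = play F t (length h) \<longleftrightarrow>
     (\<forall>m<length h. h ! m = t (mover F (take m h)) (take m h))"
  by (induction h rule: rev_induct) (auto simp: nth_append less_Suc_eq)

lemma consistent_runs_iff:
  "r \<in> consistent_runs G s \<longleftrightarrow>
     (\<forall>k. r k = s (active G (position_along r k)) (position_along r k))"
  by (auto simp: consistent_runs_def consistent_def)

definition replace_recent :: "'a run \<Rightarrow> 'a list \<Rightarrow> 'a run" where
  "replace_recent r h = (\<lambda>m. if m < length h then rev h ! m else r m)"

lemma replace_recent_recent [simp]: "replace_recent r (rev (map r [0..<n])) = r"
  by (auto simp: replace_recent_def)

lemma continue_past_along:
  assumes "length h = Suc k"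
  shows "continue_past (snd (position_along r k)) h = replace_recent r h"
  using assms by (auto simp: continue_past_def position_along_def replace_recent_def)

lemma position_along_eqI:
  assumes "\<And>j. k < j \<Longrightarrow> r j = r' j"
  shows "position_along r k = position_along r' k"
  using assms by (auto simp: position_along_def)

text \<open>Histories count stages forward from \<open>-k\<close>, runs count them backward from
  \<open>0\<close>; after \<open>m\<close> actions the stage is therefore
  \<open>-(k - m)\<close>.\<close>

lemma position_along_replace_recent:
  assumes "length h = Suc k" and "m \<le> k"
  shows "position_along (replace_recent r h) (k - m) =
           continue_position (position_along r k) (take m h)"
  using assms
  by (auto simp: position_along_def continue_position_def continue_past_def replace_recent_def
      rev_nth fun_eq_iff)

text \<open>Consistency is a condition at each stage. Before stage \<open>-k\<close> the replacement
  changes neither actions nor positions; in the last \<open>k + 1\<close> stages the condition says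
  that \<open>h\<close> is the play of the induced profile.\<close>

lemma replace_recent_consistent_iff:
  assumes len: "length h = Suc k"
  shows "replace_recent r h \<in> consistent_runs G s \<longleftrightarrow>
     h = outcome (subgame G (position_along r k)) (induced_profile s (position_along r k)) \<and>
     (\<forall>m>k. r m = s (active G (position_along r m)) (position_along r m))"
proof -
  let ?q = "position_along r k" and ?r = "replace_recent r h"
  let ?ok = "\<lambda>x m. x m = s (active G (position_along x m)) (position_along x m)"
  have old: "?ok ?r m \<longleftrightarrow> ?ok r m" if "k < m" for m
  proof -
    have "position_along ?r m = position_along r m"
      using len that by (intro position_along_eqI) (auto simp: replace_recent_def)
    then show ?thesis using len that by (simp add: replace_recent_def)
  qed
  have recent: "?ok ?r (k - m) \<longleftrightarrow>
      h ! m = induced_profile s ?q (mover (subgame G ?q) (take m h)) (take m h)"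
    if "m \<le> k" for m
  proof -
    have "?r (k - m) = h ! m"
      using len that by (simp add: replace_recent_def rev_nth less_Suc_eq_le)
    then show ?thesis
      using position_along_replace_recent[OF len that, of r]
      by (simp add: induced_profile_def subgame_def)
  qed
  have "h = outcome (subgame G ?q) (induced_profile s ?q) \<longleftrightarrow> (\<forall>m\<le>k. ?ok ?r (k - m))"
    using eq_play_iff[of h "subgame G ?q" "induced_profile s ?q"] len recent
    by (auto simp: outcome_def subgame_def position_along_def less_Suc_eq_le)
  \<comment> \<open>The index change from \<open>m\<close> to \<open>k - m\<close> is its own
    inverse on the numbers up to \<open>k\<close>.\<close>
  also have "\<dots> \<longleftrightarrow> (\<forall>m\<le>k. ?ok ?r m)"
    by (metis diff_diff_cancel diff_le_self)
  finally have "h = outcome (subgame G ?q) (induced_profile s ?q) \<longleftrightarrow> (\<forall>m\<le>k. ?ok ?r m)" .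
  moreover have "?r \<in> consistent_runs G s \<longleftrightarrow> (\<forall>m\<le>k. ?ok ?r m) \<and> (\<forall>m>k. ?ok ?r m)"
    unfolding consistent_runs_iff by (meson not_le)
  ultimately show ?thesis using old by blast
qed

lemma length_outcome_along [simp]:
  "length (outcome (subgame G (position_along r k)) t) = Suc k"
  by (simp add: outcome_def subgame_def position_along_def)

text \<open>Replacing the last \<open>k + 1\<close> actions of \<open>r\<close> by themselves leaves
  \<open>r\<close> unchanged, so by the preceding equivalence they form the outcome of the
  subgame.\<close>

lemma consistent_run_eq_outcome:
  assumes "r \<in> consistent_runs G s"
  shows "replace_recent r
    (outcome (subgame G (position_along r k)) (induced_profile s (position_along r k))) = r"
proof -
  have "rev (map r [0..<Suc k]) =
      outcome (subgame G (position_along r k)) (induced_profile s (position_along r k))"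
    using replace_recent_consistent_iff[of "rev (map r [0..<Suc k])" k r G s] assms
    by (simp del: upt_Suc)
  then show ?thesis using replace_recent_recent by metis
qed

lemma utility_subgame_along:
  assumes "length h = Suc k"
  shows "utility (subgame G (position_along r k)) i h = payoff G i (replace_recent r h)"
  using continue_past_along[OF assms] by (simp add: subgame_def)

section \<open>Deviations in a subgame as deviations in the whole game\<close>

lemma play_cong:
  assumes "\<And>i h. length h < n \<Longrightarrow> t i h = t' i h"
  shows "play F t n = play F t' n"
  using assms by (induction n) auto

lemma strong_equilibrium_imp_equilibrium:
  assumes "strong_equilibrium G s" and "consistent_runs G s = {r}"
  shows "equilibrium G s r"
proof -
  have best: "payoff G i r' \<le> payoff G i r" if "r' \<in> consistent_runs G (s(i := \<sigma>))" for i \<sigma> r'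
    using assms that unfolding strong_equilibrium_def by auto
  have r: "r \<in> consistent_runs G s" using assms by simp
  have "traditional_equilibrium G (position_along r k) (induced_profile s (position_along r k))"
    for k
    unfolding traditional_equilibrium_def pure_nash_equilibrium_def
  proof (intro allI)
    fix i \<tau>
    let ?q = "position_along r k"
    let ?F = "subgame G ?q"
    \<comment> \<open>At stage \<open>-m\<close> the subgame has seen \<open>k - m\<close> actions,
      the first entries of \<open>p\<close>; reversing them gives the chronological history for
      \<open>\<tau>\<close>. Before stage \<open>-k\<close>, \<open>\<sigma>\<close> follows
      \<open>s i\<close>, so \<open>r\<close> stays consistent there.\<close>
    define \<sigma> where "\<sigma> = (\<lambda>(m, p). if m \<le> k then \<tau> (rev (map p [0..<k - m])) else s i (m, p))"
    have "\<sigma> (continue_position ?q h) = \<tau> h" if "length h \<le> k" for h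
    proof -
      have "rev (map (continue_past (snd ?q) h) [0..<length h]) = h"
        by (rule nth_equalityI) (auto simp: continue_past_def rev_nth)
      then show ?thesis
        using that by (simp add: \<sigma>_def continue_position_def position_along_def)
    qed
    then have "outcome ?F ((induced_profile s ?q)(i := \<tau>)) =
        outcome ?F (induced_profile (s(i := \<sigma>)) ?q)"
      unfolding outcome_def
      by (intro play_cong) (auto simp: induced_profile_def subgame_def position_along_def)
    moreover have "r m = (s(i := \<sigma>)) (active G (position_along r m)) (position_along r m)"
      if "k < m" for m
    proof -
      have "r m = s (active G (position_along r m)) (position_along r m)"
        using r unfolding consistent_runs_iff by blast
      also have "\<dots> = (s(i := \<sigma>)) (active G (position_along r m)) (position_along r m)"
        using that by (simp add: \<sigma>_def position_along_def)
      finally show ?thesis .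
    qed
    then have "replace_recent r (outcome ?F (induced_profile (s(i := \<sigma>)) ?q))
        \<in> consistent_runs G (s(i := \<sigma>))"
      by (subst replace_recent_consistent_iff[where k = k])
        (simp_all only: length_outcome_along, blast)
    ultimately show "utility ?F i (outcome ?F ((induced_profile s ?q)(i := \<tau>)))
        \<le> utility ?F i (outcome ?F (induced_profile s ?q))"
      using best by (simp add: utility_subgame_along consistent_run_eq_outcome[OF r])
  qed
  then show ?thesis using r by (simp add: equilibrium_def)
qed

section \<open>Classes of runs with the same distant past\<close>

definition same_distant_past :: "'a run \<Rightarrow> 'a run \<Rightarrow> bool" where
  "same_distant_past r r' \<longleftrightarrow> (\<exists>n. \<forall>k>n. r k = r' k)"

lemma same_distant_past_refl: "same_distant_past r r"
  by (simp add: same_distant_past_def)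

lemma same_distant_past_sym: "same_distant_past r r' \<Longrightarrow> same_distant_past r' r"
  unfolding same_distant_past_def by metis

lemma same_distant_past_trans:
  assumes "same_distant_past r r'" and "same_distant_past r' r''"
  shows "same_distant_past r r''"
proof -
  obtain m n where "\<forall>k>m. r k = r' k" and "\<forall>k>n. r' k = r'' k"
    using assms by (auto simp: same_distant_past_def)
  then have "\<forall>k>max m n. r k = r'' k" by simp
  then show ?thesis unfolding same_distant_past_def by blast
qed

text \<open>As an equality of predicates, this makes the choice in \<open>representative\<close> the
  same throughout a class.\<close>

lemma same_distant_past_cong:
  "same_distant_past r r' \<Longrightarrow> same_distant_past r = same_distant_past r'"
  using same_distant_past_sym same_distant_past_trans by blast

definition representative :: "'a run \<Rightarrow> 'a run" where
  "representative r = (SOME r'. same_distant_past r r')"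

lemma same_distant_past_representative: "same_distant_past r (representative r)"
  unfolding representative_def by (rule someI[of "same_distant_past r"]) (rule same_distant_past_refl)

text \<open>The actions from the stage of the position onwards are junk.\<close>

definition run_through :: "'a position \<Rightarrow> 'a run" where
  "run_through q = (\<lambda>j. snd q (j - Suc (fst q)))"

text \<open>A position alone determines the class of the runs through it, so a strategy may depend
  on that class.\<close>

lemma same_distant_past_run_through:
  "same_distant_past (run_through (position_along r k)) = same_distant_past r"
  by (rule same_distant_past_cong)
    (auto simp: same_distant_past_def run_through_def position_along_def intro!: exI[of _ k])

definition enforce :: "'a run \<Rightarrow> ('i, 'a) profile \<Rightarrow> ('i, 'a) profile" where
  "enforce r s = (\<lambda>i q. if same_distant_past (run_through q) r then s i q
     else SOME a. a \<noteq> representative (run_through q) (fst q))"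

lemma enforce_same:
  assumes "same_distant_past r' r"
  shows "enforce r s i (position_along r' k) = s i (position_along r' k)"
  using assms by (simp add: enforce_def same_distant_past_run_through)

lemma enforce_not_same:
  fixes r :: "'a::finite run"
  assumes "card (UNIV :: 'a set) \<ge> 2" and "\<not> same_distant_past r' r"
  shows "enforce r s i (position_along r' k) \<noteq> representative r' k"
proof -
  have "\<exists>a. a \<noteq> representative r' k"
  proof (rule ccontr)
    assume "\<not> ?thesis"
    then have "(UNIV :: 'a set) = {representative r' k}" by auto
    then have "card (UNIV :: 'a set) = 1" by (metis card_1_singleton_iff One_nat_def)
    then show False using assms(1) by simp
  qed
  then have "(SOME a. a \<noteq> representative r' k) \<noteq> representative r' k" by (rule someI_ex)
  moreover have "representative (run_through (position_along r' k)) = representative r'"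
    by (simp add: representative_def same_distant_past_run_through)
  ultimately show ?thesis
    using assms(2)
    by (simp add: enforce_def same_distant_past_run_through) (simp add: position_along_def)
qed

lemma not_consistent_enforce:
  fixes r :: "'a::finite run"
  assumes "card (UNIV :: 'a set) \<ge> 2" and "\<not> same_distant_past r' r"
    and "active_infinitely_often G i r'"
  shows "\<not> consistent G i (enforce r s i) r'"
proof -
  obtain n where n: "\<forall>k>n. r' k = representative r' k"
    using same_distant_past_representative[of r'] by (auto simp: same_distant_past_def)
  obtain k where "k > n" and "active G (position_along r' k) = i"
    using assms(3) unfolding active_infinitely_often_def finite_nat_set_iff_bounded_le
    by (auto simp: not_le)
  then show ?thesis
    using n enforce_not_same[OF assms(1,2)] unfolding consistent_def by metis
qed

lemma same_distant_past_if_deviation_from_enforce: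
  fixes r :: "'a::finite run"
  assumes "card (UNIV :: 'a set) \<ge> 2" and "card {i. active_infinitely_often G i r'} \<ge> 2"
    and "r' \<in> consistent_runs G ((enforce r s)(i := \<sigma>))"
  shows "same_distant_past r' r"
proof (rule ccontr)
  assume "\<not> ?thesis"
  moreover obtain j where "active_infinitely_often G j r'" and "j \<noteq> i"
  proof -
    have "\<not> {j. active_infinitely_often G j r'} \<subseteq> {i}"
      using assms(2) card_mono[of "{i}" "{j. active_infinitely_often G j r'}"] by auto
    then show ?thesis using that by blast
  qed
  ultimately have "\<not> consistent G j (((enforce r s)(i := \<sigma>)) j) r'"
    using not_consistent_enforce[OF assms(1)] by simp
  then show False using assms(3) by (simp add: consistent_runs_def)
qed

text \<open>Beyond the last disagreement the two runs share a position, and from there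
  \<open>s\<close> determines \<open>r'\<close>.\<close>

lemma same_distant_past_consistent_eq_outcome:
  assumes "r' \<in> consistent_runs G s" and "same_distant_past r' r"
  obtains k where "r' = replace_recent r
    (outcome (subgame G (position_along r k)) (induced_profile s (position_along r k)))"
proof -
  obtain k where k: "\<forall>m>k. r' m = r m"
    using assms(2) by (auto simp: same_distant_past_def)
  have "position_along r' k = position_along r k"
    using k by (intro position_along_eqI) simp
  moreover have "replace_recent r' h = replace_recent r h" if "length h = Suc k" for h
    using k that by (auto simp: replace_recent_def)
  ultimately show ?thesis
    using consistent_run_eq_outcome[OF assms(1), of k] that by (metis length_outcome_along)
qed

section \<open>From equilibria to strong equilibria\<close>

lemma equilibrium_imp_strong_equilibrium:
  fixes r :: "'a::finite run"
  assumes card: "card (UNIV :: 'a set) \<ge> 2"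
    and two: "\<And>r. card {i. active_infinitely_often G i r} \<ge> 2"
    and eq: "equilibrium G s r"
  shows "strong_equilibrium G (enforce r s)" and "consistent_runs G (enforce r s) = {r}"
proof -
  have r: "r \<in> consistent_runs G s" using eq by (simp add: equilibrium_def)
  have deviation: "r' \<in> consistent_runs G (s(i := \<sigma>)) \<and> same_distant_past r' r"
    if r': "r' \<in> consistent_runs G ((enforce r s)(i := \<sigma>))" for r' i \<sigma>
  proof -
    have same: "same_distant_past r' r"
      using same_distant_past_if_deviation_from_enforce[OF card two r'] .
    have "((enforce r s)(i := \<sigma>)) j (position_along r' m) = (s(i := \<sigma>)) j (position_along r' m)"
      for j m by (simp add: enforce_same[OF same])
    then show ?thesis
      using r' same by (simp only: consistent_runs_iff simp_thms)
  qed
  have "r \<in> consistent_runs G (enforce r s)"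
    using r by (simp only: consistent_runs_iff enforce_same[OF same_distant_past_refl] simp_thms)
  moreover have "r' = r" if r': "r' \<in> consistent_runs G (enforce r s)" for r'
  proof -
    \<comment> \<open>A vacuous deviation, by an arbitrary player, brings \<open>r'\<close> under
      the fact \<open>deviation\<close>.\<close>
    have "r' \<in> consistent_runs G ((enforce r s)(undefined := enforce r s undefined))"
      using r' by simp
    with deviation have same: "same_distant_past r' r" by blast
    from r' have "r' \<in> consistent_runs G s"
      by (simp only: consistent_runs_iff enforce_same[OF same] simp_thms)
    \<comment> \<open>Both runs are the outcome of \<open>s\<close> from a common position, hence
      equal.\<close>
    then show ?thesis
      using same consistent_run_eq_outcome[OF r]
      by (metis same_distant_past_consistent_eq_outcome)
  qed
  ultimately show "consistent_runs G (enforce r s) = {r}" by auto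
  moreover have "payoff G i r' \<le> payoff G i r"
    if r': "r' \<in> consistent_runs G ((enforce r s)(i := \<sigma>))" for r' i \<sigma>
  proof -
    obtain k where k: "r' = replace_recent r (outcome (subgame G (position_along r k))
      (induced_profile (s(i := \<sigma>)) (position_along r k)))"
      using deviation[OF r'] same_distant_past_consistent_eq_outcome by blast
    let ?q = "position_along r k"
    \<comment> \<open>A deviation of player \<open>i\<close> from \<open>s\<close> induces a
      deviation of \<open>i\<close> alone in the subgame, to which the Nash condition
      applies.\<close>
    have "induced_profile (s(i := \<sigma>)) ?q =
        (induced_profile s ?q)(i := \<lambda>h. \<sigma> (continue_position ?q h))"
      by (auto simp: induced_profile_def)
    moreover have "pure_nash_equilibrium (subgame G ?q) (induced_profile s ?q)"
      using eq by (simp add: equilibrium_def traditional_equilibrium_def)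
    ultimately have "utility (subgame G ?q) i (outcome (subgame G ?q)
          (induced_profile (s(i := \<sigma>)) ?q))
        \<le> utility (subgame G ?q) i (outcome (subgame G ?q) (induced_profile s ?q))"
      by (simp add: pure_nash_equilibrium_def)
    then show ?thesis
      by (simp add: utility_subgame_along consistent_run_eq_outcome[OF r] flip: k)
  qed
  ultimately show "strong_equilibrium G (enforce r s)"
    unfolding strong_equilibrium_def by blast
qed

theorem theorem26:
  fixes G :: "('i::finite, 'a::finite) past_game"
  assumes "is_past_game G"
    and "\<And>r. card {i. active_infinitely_often G i r} \<ge> 2"
  shows "{r. equilibrium_run G r} = {r. strong_equilibrium_run G r}"
proof -
  have card: "card (UNIV :: 'a set) \<ge> 2" using assms(1) by (simp add: is_past_game_def)
  show ?thesis
    unfolding equilibrium_run_def strong_equilibrium_run_def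
    using strong_equilibrium_imp_equilibrium equilibrium_imp_strong_equilibrium[OF card assms(2)]
    by blast
qed

end
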